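(* Let $A$ be a ring, $h$ a central element of $A$ and $\partial$ a derivation of $A$. Then for all integers $n,d\ge1$ the following identity holds in the formal differential operator ring $A[z;\partial]$: $$(hz^d)^n=U_{n,d}\big|_{y_i=h^{[i]},\ t=z}=\sum_{k=d}^{nd}\ \sum_{\substack{\lambda\vdash nd-k\\ \ell(\lambda)\le n-1}}c^{n,d}_\lambda\,h^{\,n-\ell(\lambda)}h^{[\lambda]}z^k,$$ where $h^{[\lambda]}=h^{[\lambda_1]}\cdots h^{[\lambda_\ell]}$ for $\lambda=(\lambda_1,\ldots,\lambda_\ell)$.
   Context: Rings are associative and unital, not necessarily commutative. A derivation of a ring $A$ is an additive map $\partial:A\to A$ with $\partial(ab)=\partial(a)b+a\partial(b)$. For $h\in A$ put $h^{[i]}=\partial^i(h)$, $h^{[0]}=h$; $h^{[\emptyset]}=1$. The formal differential operator ring (skew polynomial ring) $A[z;\partial]$ is the ring containing $A$ and an element $z$ which is free as a left $A$-module with basis $\{z^i\}_{i\ge0}$, with multiplication determined by that of $A$, associativity, distributivity and the relation $za=az+\partial(a)$ for all $a\in A$. For a partition $\lambda=(\lambda_1\ge\cdots\ge\lambda_\ell>0)$, $\lambda\vdash k$ means that the sum $|\lambda|$ of its parts is $k$, and $\ell(\lambda)=\ell$ is its number of parts; $y_\lambda=\prod_{i=1}^{\ell}y_{\lambda_i}$, with $y_\emptyset=1$. Let $R=\mathbb{Z}[y_i;\ i\geq 0]$ be the commutative polynomial ring, and let $R\langle t\rangle$ be the unital ring generated over $\mathbb{Z}$ by $t$ and the $y_i$,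 subject only to $y_iy_j=y_jy_i$ for all $i,j\ge0$ (so $t$ does not commute with the $y_i$). Let $\Delta$ be the derivation of $R\langle t\rangle$ with $\Delta(y_i)=y_{i+1}$ for all $i\ge0$ and $\Delta(t)=0$, and let $\rho_t$ be right multiplication by $t$. Define $U_{0,d}=1$ and $U_{n+1,d}=y_0(\Delta+\rho_t)^dU_{n,d}$ for $n\ge0$. For $n,d\ge1$ the integers $c^{n,d}_\lambda$ are the coefficients in $$U_{n,d}=\sum_{k=d}^{nd}\ \sum_{\substack{\lambda\vdash nd-k\\ \ell(\lambda)\le n-1}}c^{n,d}_\lambda\,y_0^{\,n-\ell(\lambda)}y_\lambda t^k.$$ The evaluation $U_{n,d}|_{y_i=h^{[i]},\,t=z}$ is the image of $U_{n,d}$ under the ring homomorphism $R\langle t\rangle\to A[z;\partial]$ with $y_i\mapsto h^{[i]}$, $t\mapsto z$ (well defined since the $h^{[i]}$ commute when $h$ is central). *)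

theory Defs
  imports "HOL-Library.Multiset" "HOL-Library.Poly_Mapping" "HOL-Algebra.UnivPoly"
begin

section \<open>Derivations and formal differential operator rings\<close>

definition derivation :: "('a, 'm) ring_scheme \<Rightarrow> ('a \<Rightarrow> 'a) \<Rightarrow> bool" where
  "derivation A D \<longleftrightarrow>
     D \<in> carrier A \<rightarrow> carrier A \<and>
     (\<forall>a\<in>carrier A. \<forall>b\<in>carrier A. D (a \<oplus>\<^bsub>A\<^esub> b) = D a \<oplus>\<^bsub>A\<^esub> D b) \<and>
     (\<forall>a\<in>carrier A. \<forall>b\<in>carrier A. D (a \<otimes>\<^bsub>A\<^esub> b) = D a \<otimes>\<^bsub>A\<^esub> b \<oplus>\<^bsub>A\<^esub> a \<otimes>\<^bsub>A\<^esub> D b)"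

text \<open>
  \<open>diff_op_ring A D B \<iota> z\<close>: the ring \<open>B\<close>, with the embedding \<open>\<iota>\<close> of \<open>A\<close> and the element \<open>z\<close>,
  is the formal differential operator ring $A[z;\partial]$.  Coefficient families are the finitely
  supported sequences \<^term>\<open>up A\<close>; uniqueness of the family is freeness over the powers of \<open>z\<close>
  (and makes \<open>\<iota>\<close> injective).  These conditions determine \<open>B\<close> up to isomorphism; a model is
  constructed below.
\<close>

definition diff_op_ring ::
  "('a, 'm) ring_scheme \<Rightarrow> ('a \<Rightarrow> 'a) \<Rightarrow> ('b, 'k) ring_scheme \<Rightarrow> ('a \<Rightarrow> 'b) \<Rightarrow> 'b \<Rightarrow> bool" where
  "diff_op_ring A D B \<iota> z \<longleftrightarrow>
     ring B \<and> \<iota> \<in> ring_hom A B \<and> z \<in> carrier B \<and>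
     (\<forall>b\<in>carrier B. \<exists>!a. a \<in> up A \<and>
        b = (\<Oplus>\<^bsub>B\<^esub>i\<in>{i. a i \<noteq> \<zero>\<^bsub>A\<^esub>}. \<iota> (a i) \<otimes>\<^bsub>B\<^esub> z [^]\<^bsub>B\<^esub> i)) \<and>
     (\<forall>a\<in>carrier A. z \<otimes>\<^bsub>B\<^esub> \<iota> a = \<iota> a \<otimes>\<^bsub>B\<^esub> z \<oplus>\<^bsub>B\<^esub> \<iota> (D a))"


section \<open>The ring $R\langle t\rangle$\<close>

text \<open>
  The monoid generated by \<open>t\<close> and the \<open>y\<^sub>i\<close> subject only to \<open>y\<^sub>i y\<^sub>j = y\<^sub>j y\<^sub>i\<close>, written additively
  because \<^theory>\<open>HOL-Library.Poly_Mapping\<close> provides monoid rings over additive monoids;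
  $R\langle t\rangle$ is its integral monoid ring.
\<close>

datatype gen = T | Y nat

inductive comm_eq :: "gen list \<Rightarrow> gen list \<Rightarrow> bool" where
  refl: "comm_eq u u"
| sym: "comm_eq u v \<Longrightarrow> comm_eq v u"
| trans: "comm_eq u v \<Longrightarrow> comm_eq v w \<Longrightarrow> comm_eq u w"
| swap: "comm_eq (u @ [Y i, Y j] @ v) (u @ [Y j, Y i] @ v)"

lemma comm_eq_append_left: "comm_eq u v \<Longrightarrow> comm_eq (w @ u) (w @ v)"
proof (induction rule: comm_eq.induct)
  case (swap u i j v)
  show ?case using comm_eq.swap[of "w @ u" i j v] by simp
qed (auto intro: comm_eq.intros)

lemma comm_eq_append_right: "comm_eq u v \<Longrightarrow> comm_eq (u @ w) (v @ w)"
proof (induction rule: comm_eq.induct)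
  case (swap u i j v)
  show ?case using comm_eq.swap[of u i j "v @ w"] by simp
qed (auto intro: comm_eq.intros)

quotient_type mono = "gen list" / comm_eq
  by (rule equivpI) (auto intro!: reflpI sympI transpI intro: comm_eq.intros)

instantiation mono :: monoid_add
begin

lift_definition zero_mono :: mono is "[]" .

lift_definition plus_mono :: "mono \<Rightarrow> mono \<Rightarrow> mono" is "(@)"
  by (blast intro: comm_eq.trans comm_eq_append_left comm_eq_append_right)

instance
  by standard (transfer, simp add: comm_eq.refl)+

end

type_synonym rt = "mono \<Rightarrow>\<^sub>0 int"

definition word :: "gen list \<Rightarrow> rt" where
  "word w = Poly_Mapping.single (abs_mono w) 1"

definition tvar :: rt where "tvar = word [T]"

definition yvar :: "nat \<Rightarrow> rt" where "yvar i = word [Y i]"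

definition RT :: "rt ring" where
  "RT = \<lparr>carrier = UNIV, mult = (*), one = 1, zero = 0, add = (+)\<rparr>"

lemma word_Nil: "word [] = 1"
  by (simp add: word_def flip: zero_mono.abs_eq)

lemma word_append: "word (u @ v) = word u * word v"
  by (simp add: word_def mult_single plus_mono.abs_eq)

lemma word_Cons: "word (g # w) = word [g] * word w"
  using word_append[of "[g]" w] by simp

lemma y_commute: "yvar i * yvar j = yvar j * yvar i"
proof -
  have "abs_mono [Y i, Y j] = abs_mono [Y j, Y i]"
    using comm_eq.swap[of "[]" i j "[]"] by (simp add: mono.abs_eq_iff)
  then show ?thesis
    by (simp add: yvar_def word_def mult_single plus_mono.abs_eq)
qed

lemma ring_RT: "ring RT"
proof (rule ringI)
  show "abelian_group RT"
    by (rule abelian_groupI) (auto simp: RT_def add_ac intro: exI[of _ "- x" for x])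
  show "Group.monoid RT"
    by (rule Group.monoidI) (auto simp: RT_def mult.assoc)
qed (auto simp: RT_def algebra_simps)

text \<open>\<open>\<Delta>\<close> is given on words by the product rule and extended \<open>\<int>\<close>-linearly.\<close>

primrec Delta_word :: "gen list \<Rightarrow> rt" where
  "Delta_word [] = 0"
| "Delta_word (g # w) =
     (case g of T \<Rightarrow> 0 | Y i \<Rightarrow> yvar (Suc i)) * word w + word [g] * Delta_word w"

lemma Delta_word_append:
  "Delta_word (u @ v) = Delta_word u * word v + word u * Delta_word v"
proof (induction u)
  case (Cons g u)
  then show ?case
    by (simp add: word_append word_Cons[of g u] algebra_simps)
qed (simp add: word_Nil)

lift_definition Delta_mono :: "mono \<Rightarrow> rt" is Delta_word
proof -
  fix u v assume "comm_eq u v"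
  then have "Delta_word u = Delta_word v \<and> word u = word v"
  proof (induction rule: comm_eq.induct)
    case (swap u i j v)
    have "word [Y i, Y j] = word [Y j, Y i]"
      using y_commute[of i j] by (simp add: yvar_def flip: word_append)
    moreover have "Delta_word [Y i, Y j] = Delta_word [Y j, Y i]"
      using y_commute[of i "Suc j"] y_commute[of j "Suc i"]
      by (simp add: word_Nil yvar_def[symmetric])
    ultimately show ?case
      by (simp only: Delta_word_append word_append)
  qed auto
  then show "Delta_word u = Delta_word v" ..
qed

definition Delta :: "rt \<Rightarrow> rt" where
  "Delta x = (\<Sum>m\<in>Poly_Mapping.keys x. of_int (Poly_Mapping.lookup x m) * Delta_mono m)"

primrec U :: "nat \<Rightarrow> nat \<Rightarrow> rt" where
  "U 0 d = 1"
| "U (Suc n) d = yvar 0 * ((\<lambda>x. Delta x + x * tvar) ^^ d) (U n d)"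

text \<open>The evaluation $R\langle t\rangle\to B$ with \<open>y\<^sub>i \<mapsto> f i\<close> and \<open>t \<mapsto> b\<close>; it is a ring homomorphism
  if the \<open>f i\<close> commute pairwise (\<open>evaluation_hom\<close>).  The choice of representing word made by
  \<^const>\<open>rep_mono\<close> is immaterial in that case.\<close>

primrec evaluation_word :: "('b, 'k) ring_scheme \<Rightarrow> (nat \<Rightarrow> 'b) \<Rightarrow> 'b \<Rightarrow> gen list \<Rightarrow> 'b" where
  "evaluation_word B f b [] = \<one>\<^bsub>B\<^esub>"
| "evaluation_word B f b (g # w) = (case g of T \<Rightarrow> b | Y i \<Rightarrow> f i) \<otimes>\<^bsub>B\<^esub> evaluation_word B f b w"

definition evaluation :: "('b, 'k) ring_scheme \<Rightarrow> (nat \<Rightarrow> 'b) \<Rightarrow> 'b \<Rightarrow> rt \<Rightarrow> 'b" where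
  "evaluation B f b x =
     (\<Oplus>\<^bsub>B\<^esub>m\<in>Poly_Mapping.keys x.
        [Poly_Mapping.lookup x m] \<cdot>\<^bsub>B\<^esub> evaluation_word B f b (rep_mono m))"


section \<open>Partitions and coefficients\<close>

definition partitions :: "nat \<Rightarrow> nat list set" where
  "partitions k = {p. sorted_wrt (\<ge>) p \<and> (\<forall>i\<in>set p. 0 < i) \<and> sum_list p = k}"

text \<open>The coefficient of $y_0^{n-\ell(\lambda)}y_\lambda t^{nd-|\lambda|}$ in $U_{n,d}$.\<close>

definition coeff_U :: "nat \<Rightarrow> nat \<Rightarrow> nat list \<Rightarrow> int" where
  "coeff_U n d p = Poly_Mapping.lookup (U n d)
     (abs_mono (replicate (n - length p) (Y 0) @ map Y p @ replicate (n * d - sum_list p) T))"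

definition deriv_prod :: "('a, 'm) ring_scheme \<Rightarrow> ('a \<Rightarrow> 'a) \<Rightarrow> 'a \<Rightarrow> nat list \<Rightarrow> 'a" where
  "deriv_prod A D h p = foldr (\<lambda>i x. (D ^^ i) h \<otimes>\<^bsub>A\<^esub> x) p \<one>\<^bsub>A\<^esub>"


section \<open>The constructions have the intended properties\<close>

subsection \<open>\<open>\<Delta>\<close> is the derivation with the prescribed values\<close>

lemma rt_expand: "x = (\<Sum>m\<in>Poly_Mapping.keys x. Poly_Mapping.single m (Poly_Mapping.lookup x m))"
  by (rule poly_mapping_eqI)
     (auto simp: lookup_sum lookup_single when_def in_keys_iff sum.delta)

lemma rt_induct [case_names add minus zero word]:
  assumes "\<And>x z. P x \<Longrightarrow> P z \<Longrightarrow> P (x + z)" "\<And>x. P x \<Longrightarrow> P (- x)" "P 0" "\<And>w. P (word w)"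
  shows "P x"
proof -
  have nat: "P (Poly_Mapping.single m (int k))" for m k
  proof (induction k)
    case (Suc k)
    obtain w where "m = abs_mono w"
      using Quotient3_abs_rep[OF Quotient3_mono, of m] by metis
    then have "Poly_Mapping.single m (int (Suc k)) = word w + Poly_Mapping.single m (int k)"
      by (simp add: word_def flip: single_add)
    then show ?case using assms Suc by metis
  qed (simp add: assms)
  have "P (Poly_Mapping.single m c)" for m c
  proof (cases c rule: int_cases2)
    case (nonneg k) then show ?thesis using nat by simp
  next
    case (nonpos k) then show ?thesis using assms(2)[OF nat[of m k]] by (simp add: single_uminus)
  qed
  then have "finite M \<Longrightarrow> P (\<Sum>m\<in>M. Poly_Mapping.single m (Poly_Mapping.lookup x m))" for M
    by (induction M rule: infinite_finite_induct) (auto intro: assms)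
  then show ?thesis by (subst rt_expand) simp
qed

lemma Delta_superset:
  assumes "finite M" "Poly_Mapping.keys x \<subseteq> M"
  shows "Delta x = (\<Sum>m\<in>M. of_int (Poly_Mapping.lookup x m) * Delta_mono m)"
  unfolding Delta_def by (rule sum.mono_neutral_left) (use assms in \<open>auto simp: in_keys_iff\<close>)

lemma Delta_add: "Delta (x + z) = Delta x + Delta z"
proof -
  let ?M = "Poly_Mapping.keys x \<union> Poly_Mapping.keys z"
  have "Poly_Mapping.keys (x + z) \<subseteq> ?M" by (rule keys_add)
  then show ?thesis
    by (simp add: Delta_superset[of ?M] lookup_add distrib_right sum.distrib)
qed

lemma Delta_0: "Delta 0 = 0"
  by (simp add: Delta_def)

lemma Delta_minus: "Delta (- x) = - Delta x"
  using Delta_add[of x "- x"] by (simp add: Delta_0 eq_neg_iff_add_eq_0 add.commute)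

lemma Delta_word: "Delta (word w) = Delta_word w"
  by (simp add: Delta_def word_def Delta_mono.abs_eq)

lemma Delta_mult: "Delta (x * z) = Delta x * z + x * Delta z"
proof (induction x rule: rt_induct)
  case (word u)
  show ?case
  proof (induction z rule: rt_induct)
    case (word v)
    show ?case
      by (simp add: Delta_word Delta_word_append flip: word_append)
  qed (auto simp: Delta_add Delta_minus Delta_0 algebra_simps)
qed (auto simp: Delta_add Delta_minus Delta_0 algebra_simps)

lemma Delta_derivation: "derivation RT Delta"
  by (simp add: derivation_def RT_def Delta_add Delta_mult)

lemma Delta_y: "Delta (yvar i) = yvar (Suc i)" and Delta_t: "Delta tvar = 0"
  by (simp_all add: yvar_def tvar_def Delta_word word_Nil)

lemma Delta_unique:
  assumes "derivation RT D" "\<And>i. D (yvar i) = yvar (Suc i)" "D tvar = 0"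
  shows "D = Delta"
proof
  have add: "D (x + z) = D x + D z" and mult: "D (x * z) = D x * z + x * D z" for x z
    using assms(1) by (auto simp: derivation_def RT_def)
  have D0: "D 0 = 0" using add[of 0 0] by simp
  have minus: "D (- x) = - D x" for x
    using add[of x "- x"] by (simp add: D0 eq_neg_iff_add_eq_0 add.commute)
  have D1: "D 1 = 0" using mult[of 1 1] by simp
  have "D (word w) = Delta (word w)" for w
  proof (induction w)
    case (Cons g w)
    have "D (word [g]) = Delta (word [g])"
      using assms(2,3) Delta_y Delta_t by (cases g) (auto simp: yvar_def tvar_def)
    then show ?case
      by (subst (1 2) word_Cons) (simp only: mult Delta_mult Cons)
  qed (simp add: word_Nil D1 Delta_word[of "[]", simplified word_Nil])
  then show "D x = Delta x" for x
    by (induction x rule: rt_induct) (simp_all add: add minus D0 Delta_add Delta_minus Delta_0)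
qed


subsection \<open>The monomials $y_0^i y_\lambda t^k$ are distinct and there are finitely many partitions\<close>

lemma comm_eq_mset: "comm_eq u v \<Longrightarrow> mset u = mset v"
  by (induction rule: comm_eq.induct) (auto simp: add_mset_commute)

lemma monomial_inj:
  assumes p: "p \<in> partitions a" and q: "q \<in> partitions b"
    and eq: "abs_mono (replicate i (Y 0) @ map Y p @ replicate k T) =
             abs_mono (replicate j (Y 0) @ map Y q @ replicate l T)"
  shows "i = j \<and> p = q \<and> k = l"
proof -
  let ?u = "replicate i (Y 0) @ map Y p @ replicate k T"
  let ?v = "replicate j (Y 0) @ map Y q @ replicate l T"
  have "comm_eq ?u ?v" using eq by (simp only: mono.abs_eq_iff)
  then have m: "mset ?u = mset ?v" by (rule comm_eq_mset)
  have cnt: "count (mset ?u) g = count (mset ?v) g" for g using m by simp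
  have Ycount: "count (image_mset Y M) (Y x) = count M x" for M x
    by (induction M) auto
  have Tcount: "count (image_mset Y M) T = 0" for M
    by (induction M) auto
  have pos: "count (mset p) 0 = 0" "count (mset q) 0 = 0"
    using p q by (auto simp: partitions_def count_eq_zero_iff)
  have "k = l" using cnt[of T] by (simp add: Tcount)
  moreover have "i = j" using cnt[of "Y 0"] pos by (simp add: Ycount)
  moreover have "mset p = mset q"
  proof (rule multiset_eqI)
    show "count (mset p) x = count (mset q) x" for x
      using cnt[of "Y x"] \<open>i = j\<close> by (simp add: Ycount split: if_splits)
  qed
  then have "p = q"
  proof -
    have "sorted (rev p)" "sorted (rev q)" using p q by (auto simp: partitions_def sorted_wrt_rev)
    then have "rev p = rev q" using \<open>mset p = mset q\<close> by (metis mset_rev properties_for_sort)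
    then show ?thesis by simp
  qed
  ultimately show ?thesis by simp
qed

lemma finite_partitions: "finite (partitions k)"
proof (rule finite_subset)
  show "partitions k \<subseteq> {p. set p \<subseteq> {..k} \<and> length p \<le> k}"
  proof
    fix p assume p: "p \<in> partitions k"
    then have "x \<le> k" if "x \<in> set p" for x
      using that by (auto simp: partitions_def intro: member_le_sum_list)
    moreover have "length q \<le> sum_list q" if "\<forall>i\<in>set q. 0 < i" for q :: "nat list"
      using that by (induction q) auto
    ultimately show "p \<in> {p. set p \<subseteq> {..k} \<and> length p \<le> k}"
      using p by (auto simp: partitions_def)
  qed
qed (simp add: finite_lists_length_le)


subsection \<open>Evaluation is the ring homomorphism with the prescribed values\<close>

locale evaluation_data = ring B for B (structure) +
  fixes f :: "nat \<Rightarrow> 'b" and b :: 'b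
  assumes f_closed [simp, intro]: "f i \<in> carrier B"
    and b_closed [simp, intro]: "b \<in> carrier B"
    and f_commute: "f i \<otimes> f j = f j \<otimes> f i"
begin

abbreviation "ew \<equiv> evaluation_word B f b"

abbreviation "ev \<equiv> evaluation B f b"

lemma ew_closed [simp, intro]: "ew w \<in> carrier B"
  by (induction w) (auto split: gen.split)

lemma ew_append: "ew (u @ v) = ew u \<otimes> ew v"
  by (induction u) (auto simp: m_assoc split: gen.split)

lemma ew_comm_eq: "comm_eq u v \<Longrightarrow> ew u = ew v"
proof (induction rule: comm_eq.induct)
  case (swap u i j v)
  have "ew [Y i, Y j] = ew [Y j, Y i]" by (simp add: f_commute)
  then show ?case by (simp only: ew_append)
qed auto

lemma ew_rep: "ew (rep_mono (abs_mono w)) = ew w"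
proof -
  have "comm_eq (rep_mono (abs_mono w)) w"
    by (simp add: Quotient3_rep_abs[OF Quotient3_mono] comm_eq.refl)
  then show ?thesis by (rule ew_comm_eq)
qed

lemma ev_closed [simp, intro]: "ev x \<in> carrier B"
  unfolding evaluation_def by (auto intro!: finsum_closed)

lemma ev_superset:
  assumes "finite M" "Poly_Mapping.keys x \<subseteq> M"
  shows "ev x = (\<Oplus>m\<in>M. [Poly_Mapping.lookup x m] \<cdot> ew (rep_mono m))"
  unfolding evaluation_def
  by (rule add.finprod_mono_neutral_cong_left) (use assms in \<open>auto simp: in_keys_iff add_pow_int_ge\<close>)

lemma ev_add: "ev (x + z) = ev x \<oplus> ev z"
proof -
  let ?M = "Poly_Mapping.keys x \<union> Poly_Mapping.keys z"
  have "Poly_Mapping.keys (x + z) \<subseteq> ?M" by (rule keys_add)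
  then show ?thesis
    by (simp add: ev_superset[of ?M] lookup_add add.int_pow_mult[symmetric] flip: finsum_addf)
qed

lemma ev_0: "ev 0 = \<zero>"
  by (simp add: evaluation_def)

lemma ev_minus: "ev (- x) = \<ominus> ev x"
  using ev_add[of "- x" x] by (simp add: ev_0 minus_equality)

lemma ev_word: "ev (word w) = ew w"
  by (simp add: evaluation_def word_def ew_rep)

lemma ev_mult: "ev (x * z) = ev x \<otimes> ev z"
proof (induction x rule: rt_induct)
  case (word u)
  show ?case
  proof (induction z rule: rt_induct)
    case (word v)
    show ?case by (simp add: ev_word ew_append flip: word_append)
  qed (auto simp: ev_add ev_minus ev_0 distrib_left r_distr r_minus)
qed (auto simp: ev_add ev_minus ev_0 distrib_right l_distr l_minus)

lemma evaluation_hom: "ev \<in> ring_hom RT B"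
  using ev_word[of "[]"] by (auto simp: ring_hom_def RT_def ev_add ev_mult word_Nil)

lemma evaluation_yvar: "ev (yvar i) = f i" and evaluation_tvar: "ev tvar = b"
  by (simp_all add: yvar_def tvar_def ev_word)

lemma evaluation_unique:
  assumes "\<phi> \<in> ring_hom RT B" "\<And>i. \<phi> (yvar i) = f i" "\<phi> tvar = b"
  shows "\<phi> = ev"
proof
  have add: "\<phi> (x + z) = \<phi> x \<oplus> \<phi> z" and mult: "\<phi> (x * z) = \<phi> x \<otimes> \<phi> z"
    and one: "\<phi> 1 = \<one>" and closed [simp]: "\<phi> x \<in> carrier B" for x z
    using assms(1) by (auto simp: ring_hom_def RT_def)
  have zero: "\<phi> 0 = \<zero>"
    using add[of 0 0] by (metis add.l_cancel_one closed add_0)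
  have minus: "\<phi> (- x) = \<ominus> \<phi> x" for x
    using add[of "- x" x] by (simp add: zero minus_equality)
  have "\<phi> (word w) = ev (word w)" for w
  proof (induction w)
    case (Cons g w)
    have "\<phi> (word [g]) = ev (word [g])"
      using assms(2,3) evaluation_yvar evaluation_tvar
      by (cases g) (auto simp: yvar_def tvar_def)
    then show ?case
      by (subst (1 2) word_Cons) (simp only: mult ev_mult Cons)
  qed (simp add: word_Nil one ev_word[of "[]", simplified word_Nil])
  then show "\<phi> x = ev x" for x
    by (induction x rule: rt_induct) (simp_all add: add minus zero ev_add ev_minus ev_0)
qed

end


subsection \<open>Existence of $A[z;\partial]$\<close>

locale derivation_ring = ring A for A (structure) +
  fixes D :: "'a \<Rightarrow> 'a"
  assumes der: "derivation A D"
begin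

lemma D_closed [simp, intro]: "a \<in> carrier A \<Longrightarrow> D a \<in> carrier A"
  using der by (auto simp: derivation_def)

lemma D_add: "a \<in> carrier A \<Longrightarrow> b \<in> carrier A \<Longrightarrow> D (a \<oplus> b) = D a \<oplus> D b"
  using der by (auto simp: derivation_def)

lemma D_mult: "a \<in> carrier A \<Longrightarrow> b \<in> carrier A \<Longrightarrow> D (a \<otimes> b) = D a \<otimes> b \<oplus> a \<otimes> D b"
  using der by (auto simp: derivation_def)

lemma D_zero [simp]: "D \<zero> = \<zero>"
  using D_add[of \<zero> \<zero>] by (metis add.l_cancel_one D_closed l_zero zero_closed)

lemma D_one [simp]: "D \<one> = \<zero>"
  using D_mult[of \<one> \<one>] by (metis add.l_cancel_one D_closed l_one r_one one_closed)

lemma D_finsum: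
  "finite S \<Longrightarrow> g \<in> S \<rightarrow> carrier A \<Longrightarrow> D (\<Oplus>i\<in>S. g i) = (\<Oplus>i\<in>S. D (g i))"
  by (induction S rule: finite_induct) (auto simp: D_add Pi_def)

text \<open>A sequence \<open>q\<close> stands for $\sum_j q_j z^j$; \<open>Z\<close> is left multiplication by \<open>z\<close>.\<close>

definition Z :: "(nat \<Rightarrow> 'a) \<Rightarrow> nat \<Rightarrow> 'a" where
  "Z q j = (if j = 0 then \<zero> else q (j - 1)) \<oplus> D (q j)"

definition diff_mult :: "(nat \<Rightarrow> 'a) \<Rightarrow> (nat \<Rightarrow> 'a) \<Rightarrow> nat \<Rightarrow> 'a" where
  "diff_mult p q j = (\<Oplus>i\<in>{i. p i \<noteq> \<zero>}. p i \<otimes> (Z ^^ i) q j)"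

definition diff_ring :: "(nat \<Rightarrow> 'a) ring" where
  "diff_ring = \<lparr>carrier = up A, mult = diff_mult,
     one = (\<lambda>j. if j = 0 then \<one> else \<zero>),
     zero = (\<lambda>j. \<zero>), add = (\<lambda>p q j. p j \<oplus> q j)\<rparr>"

definition seq :: "(nat \<Rightarrow> 'a) \<Rightarrow> bool" where "seq p \<longleftrightarrow> (\<forall>i. p i \<in> carrier A)"

lemma seqD [simp, intro]: "seq p \<Longrightarrow> p i \<in> carrier A"
  by (simp add: seq_def)

lemma up_iff: "p \<in> up A \<longleftrightarrow> seq p \<and> (\<exists>n. \<forall>m>n. p m = \<zero>)"
  by (auto simp: up_def seq_def bound_def)

lemma Z_seq [simp, intro]: "seq q \<Longrightarrow> seq (Z q)"
  by (auto simp: seq_def Z_def)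

lemma Zi_seq [simp, intro]: "seq q \<Longrightarrow> seq ((Z ^^ i) q)"
  by (induction i) auto

lemma Zi_bound: "\<forall>m>n. q m = \<zero> \<Longrightarrow> \<forall>m>n + i. (Z ^^ i) q m = \<zero>"
  by (induction i) (auto simp: Z_def)

lemma Zi_add:
  assumes "seq p" "seq q"
  shows "(Z ^^ i) (\<lambda>j. p j \<oplus> q j) = (\<lambda>j. (Z ^^ i) p j \<oplus> (Z ^^ i) q j)"
proof (induction i)
  case (Suc i)
  have "Z (\<lambda>j. f j \<oplus> g j) = (\<lambda>j. Z f j \<oplus> Z g j)" if "seq f" "seq g" for f g
    using that by (auto simp: Z_def D_add a_ac seqD intro!: ext)
  then show ?case using assms Suc by simp
qed simp

lemma diff_mult_superset:
  assumes "\<forall>m>n. p m = \<zero>" "seq p" "seq q"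
  shows "diff_mult p q j = (\<Oplus>i\<in>{..n}. p i \<otimes> (Z ^^ i) q j)"
proof -
  have "{i. p i \<noteq> \<zero>} \<subseteq> {..n}" using assms(1) by (auto simp: not_less[symmetric])
  then show ?thesis unfolding diff_mult_def
    by (intro add.finprod_mono_neutral_cong_left) (use assms in auto)
qed

lemma diff_mult_seq [simp, intro]: "seq p \<Longrightarrow> seq q \<Longrightarrow> seq (diff_mult p q)"
  unfolding seq_def[of "diff_mult p q"] diff_mult_def by (auto intro!: finsum_closed)

lemma diff_mult_up [simp, intro]:
  assumes "p \<in> up A" "q \<in> up A"
  shows "diff_mult p q \<in> up A"
proof -
  obtain n m where n: "\<forall>k>n. p k = \<zero>" and m: "\<forall>k>m. q k = \<zero>"
    using assms by (auto simp: up_iff)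
  have "diff_mult p q k = \<zero>" if "k > m + n" for k
  proof -
    have "diff_mult p q k = (\<Oplus>i\<in>{..n}. p i \<otimes> (Z ^^ i) q k)"
      using assms n by (intro diff_mult_superset) (auto simp: up_iff)
    also have "\<dots> = (\<Oplus>i\<in>{..n}. \<zero>)"
      by (rule finsum_cong') (use Zi_bound[OF m] that assms in \<open>auto simp: up_iff\<close>)
    finally show ?thesis by simp
  qed
  then show ?thesis using assms by (auto simp: up_iff)
qed

lemma diff_mult_distl:
  assumes "p \<in> up A" "q \<in> up A" "seq r"
  shows "diff_mult (\<lambda>j. p j \<oplus> q j) r = (\<lambda>j. diff_mult p r j \<oplus> diff_mult q r j)"
proof
  fix j
  obtain n m where n: "\<forall>k>n. p k = \<zero>" and m: "\<forall>k>m. q k = \<zero>"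
    using assms by (auto simp: up_iff)
  have s: "seq p" "seq q" using assms by (auto simp: up_iff)
  show "diff_mult (\<lambda>j. p j \<oplus> q j) r j = diff_mult p r j \<oplus> diff_mult q r j"
    using n m s assms(3)
    by (subst (1 2 3) diff_mult_superset[of "max n m"])
       (auto simp: l_distr seq_def[of "\<lambda>j. p j \<oplus> q j"] simp flip: finsum_addf)
qed

lemma diff_mult_distr:
  assumes "seq p" "seq q" "seq r"
  shows "diff_mult p (\<lambda>j. q j \<oplus> r j) = (\<lambda>j. diff_mult p q j \<oplus> diff_mult p r j)"
  using assms by (auto simp: diff_mult_def Zi_add r_distr fun_eq_iff simp flip: finsum_addf)

lemma diff_mult_Z:
  assumes q: "q \<in> up A" and r: "seq r"
  shows "diff_mult (Z q) r = Z (diff_mult q r)"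
proof
  fix j
  obtain n where n: "\<forall>k>n. q k = \<zero>" using q by (auto simp: up_iff)
  have n': "\<forall>k>Suc n. q k = \<zero>" using n by auto
  have sq [simp]: "seq q" using q by (auto simp: up_iff)
  have Zn: "\<forall>k>Suc n. Z q k = \<zero>" using Zi_bound[OF n, of 1] by simp
  let ?R = "\<lambda>i. (Z ^^ i) r"
  have R [simp]: "?R i k \<in> carrier A" for i k using r by auto
  have 1: "(\<Oplus>i\<in>{..Suc n}. (if i = 0 then \<zero> else q (i - 1)) \<otimes> ?R i j)
      = (\<Oplus>i\<in>{..n}. q i \<otimes> ?R (Suc i) j)"
    using r by (subst finsum_Suc2) (auto simp del: funpow.simps(2))
  have 2: "(\<Oplus>i\<in>{..Suc n}. D (q i) \<otimes> ?R i j) = (\<Oplus>i\<in>{..n}. D (q i) \<otimes> ?R i j)"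
    using n by (subst finsum_Suc) (auto simp del: funpow.simps)
  have 3: "?R (Suc i) j = (if j = 0 then \<zero> else ?R i (j - 1)) \<oplus> D (?R i j)" for i
    by (simp add: Z_def)
  have "diff_mult (Z q) r j = (\<Oplus>i\<in>{..Suc n}. Z q i \<otimes> ?R i j)"
    by (rule diff_mult_superset) (use Zn r in auto)
  also have "\<dots> = (\<Oplus>i\<in>{..Suc n}. (if i = 0 then \<zero> else q (i - 1)) \<otimes> ?R i j \<oplus> D (q i) \<otimes> ?R i j)"
    by (rule finsum_cong') (auto simp: Z_def l_distr)
  also have "\<dots> = (\<Oplus>i\<in>{..n}. q i \<otimes> ?R (Suc i) j) \<oplus> (\<Oplus>i\<in>{..n}. D (q i) \<otimes> ?R i j)"
    unfolding 1[symmetric] 2[symmetric] by (rule finsum_addf) auto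
  also have "\<dots> = (\<Oplus>i\<in>{..n}. q i \<otimes> ?R (Suc i) j \<oplus> D (q i) \<otimes> ?R i j)"
    by (rule finsum_addf[symmetric]) (auto simp del: funpow.simps)
  also have "\<dots> = (\<Oplus>i\<in>{..n}. (if j = 0 then \<zero> else q i \<otimes> ?R i (j - 1)) \<oplus> D (q i \<otimes> ?R i j))"
    by (rule finsum_cong') (auto simp: 3 D_mult r_distr a_ac simp del: funpow.simps)
  also have "\<dots> = (\<Oplus>i\<in>{..n}. if j = 0 then \<zero> else q i \<otimes> ?R i (j - 1))
      \<oplus> (\<Oplus>i\<in>{..n}. D (q i \<otimes> ?R i j))"
    by (rule finsum_addf) auto
  also have "\<dots> = (if j = 0 then \<zero> else \<Oplus>i\<in>{..n}. q i \<otimes> ?R i (j - 1))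
      \<oplus> D (\<Oplus>i\<in>{..n}. q i \<otimes> ?R i j)"
    by (simp add: D_finsum)
  also have "\<dots> = Z (diff_mult q r) j"
    using n r by (simp add: Z_def diff_mult_superset[of n])
  finally show "diff_mult (Z q) r j = Z (diff_mult q r) j" .
qed

lemma Z_up [simp, intro]: "q \<in> up A \<Longrightarrow> Z q \<in> up A"
  unfolding up_iff using Zi_bound[of _ q 1] by fastforce

lemma Zi_up [simp, intro]: "q \<in> up A \<Longrightarrow> (Z ^^ i) q \<in> up A"
  by (induction i) auto

lemma diff_mult_Zi:
  assumes "q \<in> up A" "seq r"
  shows "diff_mult ((Z ^^ i) q) r = (Z ^^ i) (diff_mult q r)"
  by (induction i) (use assms in \<open>auto simp: diff_mult_Z\<close>)

lemma finsum_swap: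
  assumes "finite S" "finite S'" "\<And>i j. g i j \<in> carrier A"
  shows "(\<Oplus>i\<in>S. \<Oplus>j\<in>S'. g i j) = (\<Oplus>j\<in>S'. \<Oplus>i\<in>S. g i j)"
  using assms(1)
proof (induction S rule: finite_induct)
  case (insert x S)
  then show ?case using assms by (simp add: finsum_addf Pi_def)
qed (use assms in simp)

lemma diff_mult_assoc:
  assumes p: "p \<in> up A" and q: "q \<in> up A" and r: "r \<in> up A"
  shows "diff_mult (diff_mult p q) r = diff_mult p (diff_mult q r)"
proof
  fix j
  obtain n m where n: "\<forall>k>n. p k = \<zero>" and m: "\<forall>k>m. q k = \<zero>"
    using p q by (auto simp: up_iff)
  have s [simp]: "seq p" "seq q" "seq r" using assms by (auto simp: up_iff)
  have Zq: "\<forall>k>m + n. (Z ^^ i) q k = \<zero>" if "i \<le> n" for i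
    using Zi_bound[OF m, of i] that by auto
  have pq: "diff_mult p q k = (\<Oplus>i\<in>{..n}. p i \<otimes> (Z ^^ i) q k)" for k
    by (rule diff_mult_superset) (use n in auto)
  have "diff_mult p q k = \<zero>" if "k > m + n" for k
  proof -
    have "diff_mult p q k = (\<Oplus>i\<in>{..n}. \<zero>)"
      unfolding pq by (rule finsum_cong') (use Zq that in auto)
    then show ?thesis by simp
  qed
  then have "diff_mult (diff_mult p q) r j
      = (\<Oplus>k\<in>{..m + n}. diff_mult p q k \<otimes> (Z ^^ k) r j)"
    by (intro diff_mult_superset) auto
  also have "\<dots> = (\<Oplus>k\<in>{..m + n}. \<Oplus>i\<in>{..n}. p i \<otimes> ((Z ^^ i) q k \<otimes> (Z ^^ k) r j))"
    by (rule finsum_cong') (auto simp: pq finsum_ldistr m_assoc Pi_def intro!: finsum_closed)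
  also have "\<dots> = (\<Oplus>i\<in>{..n}. \<Oplus>k\<in>{..m + n}. p i \<otimes> ((Z ^^ i) q k \<otimes> (Z ^^ k) r j))"
    by (rule finsum_swap) auto
  also have "\<dots> = (\<Oplus>i\<in>{..n}. p i \<otimes> (Z ^^ i) (diff_mult q r) j)"
  proof (rule finsum_cong')
    fix i assume "i \<in> {..n}"
    then have "(Z ^^ i) (diff_mult q r) j = (\<Oplus>k\<in>{..m + n}. (Z ^^ i) q k \<otimes> (Z ^^ k) r j)"
      using diff_mult_superset[OF Zq[of i], of r j] q by (simp add: diff_mult_Zi)
    then show "(\<Oplus>k\<in>{..m + n}. p i \<otimes> ((Z ^^ i) q k \<otimes> (Z ^^ k) r j))
        = p i \<otimes> (Z ^^ i) (diff_mult q r) j"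
      by (simp add: finsum_rdistr Pi_def)
  qed auto
  also have "\<dots> = diff_mult p (diff_mult q r) j"
    by (rule diff_mult_superset[symmetric]) (use n in auto)
  finally show "diff_mult (diff_mult p q) r j = diff_mult p (diff_mult q r) j" .
qed

definition mon :: "'a \<Rightarrow> nat \<Rightarrow> nat \<Rightarrow> 'a" where "mon a i = (\<lambda>j. if j = i then a else \<zero>)"

lemma mon_up [simp, intro]: "a \<in> carrier A \<Longrightarrow> mon a i \<in> up A"
  by (auto simp: up_iff mon_def seq_def)

lemma Z_mon_one: "Z (mon \<one> i) = mon \<one> (Suc i)"
  by (auto simp: Z_def mon_def fun_eq_iff)

lemma Zi_mon_one: "(Z ^^ i) (mon \<one> 0) = mon \<one> i"
  by (induction i) (auto simp: Z_mon_one)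

lemma diff_mult_mon:
  assumes "a \<in> carrier A" "seq q"
  shows "diff_mult (mon a i) q = (\<lambda>j. a \<otimes> (Z ^^ i) q j)"
proof
  fix j
  have "diff_mult (mon a i) q j = (\<Oplus>k\<in>{..i}. mon a i k \<otimes> (Z ^^ k) q j)"
    by (rule diff_mult_superset) (use assms in \<open>auto simp: mon_def seq_def\<close>)
  also have "\<dots> = (\<Oplus>k\<in>{..i}. if i = k then a \<otimes> (Z ^^ k) q j else \<zero>)"
    by (rule finsum_cong') (use assms in \<open>auto simp: mon_def\<close>)
  also have "\<dots> = a \<otimes> (Z ^^ i) q j"
    by (rule finsum_singleton) (use assms in auto)
  finally show "diff_mult (mon a i) q j = a \<otimes> (Z ^^ i) q j" .
qed

lemma diff_mult_one:
  assumes "p \<in> up A"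
  shows "diff_mult p (mon \<one> 0) = p"
proof
  fix j
  obtain n where n: "\<forall>k>n. p k = \<zero>" using assms by (auto simp: up_iff)
  then have n': "\<forall>k>n + j. p k = \<zero>" by auto
  have s [simp]: "seq p" "seq (mon \<one> 0)" using assms mon_up[of \<one> 0] by (auto simp: up_iff)
  have "diff_mult p (mon \<one> 0) j = (\<Oplus>i\<in>{..n + j}. p i \<otimes> (Z ^^ i) (mon \<one> 0) j)"
    by (rule diff_mult_superset) (use n' in auto)
  also have "\<dots> = (\<Oplus>i\<in>{..n + j}. if j = i then p i else \<zero>)"
    unfolding Zi_mon_one by (rule finsum_cong') (auto simp: mon_def)
  also have "\<dots> = p j"
    by (rule finsum_singleton) auto
  finally show "diff_mult p (mon \<one> 0) j = p j" .
qed

lemma up_add [simp, intro]: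
  assumes "p \<in> up A" "q \<in> up A" shows "(\<lambda>j. p j \<oplus> q j) \<in> up A"
proof -
  obtain n m where "\<forall>k>n. p k = \<zero>" "\<forall>k>m. q k = \<zero>" using assms by (auto simp: up_iff)
  then have "\<forall>k>max n m. p k \<oplus> q k = \<zero>" by auto
  moreover have "seq (\<lambda>j. p j \<oplus> q j)" using assms by (auto simp: up_iff seq_def)
  ultimately show ?thesis unfolding up_iff by blast
qed

lemma up_uminus: "p \<in> up A \<Longrightarrow> (\<lambda>j. \<ominus> p j) \<in> up A"
  unfolding up_iff seq_def by (metis a_inv_closed minus_zero)

lemma up_seq: "p \<in> up A \<Longrightarrow> seq p"
  by (simp add: up_iff)

lemma up_carrier [simp]: "p \<in> up A \<Longrightarrow> p i \<in> carrier A"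
  by (simp add: up_iff)

lemma one_eq: "(\<lambda>j. if j = 0 then \<one> else \<zero>) = mon \<one> 0"
  by (simp add: mon_def)

lemma ring_diff_ring: "ring diff_ring"
proof (rule ringI)
  show "abelian_group diff_ring"
  proof (rule abelian_groupI)
    fix p assume "p \<in> carrier diff_ring"
    then show "\<exists>q\<in>carrier diff_ring. q \<oplus>\<^bsub>diff_ring\<^esub> p = \<zero>\<^bsub>diff_ring\<^esub>"
      by (intro bexI[of _ "\<lambda>j. \<ominus> p j"]) (auto simp: diff_ring_def up_uminus l_neg)
  qed (auto simp: diff_ring_def a_ac)
  show "Group.monoid diff_ring"
    by (rule Group.monoidI)
       (auto simp: diff_ring_def diff_mult_assoc diff_mult_one one_eq diff_mult_mon up_seq)
qed (auto simp: diff_ring_def diff_mult_distl diff_mult_distr up_seq)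

lemma diff_ring_pow: "mon \<one> (Suc 0) [^]\<^bsub>diff_ring\<^esub> i = mon \<one> i"
proof (induction i)
  case (Suc i)
  have "diff_mult (mon \<one> i) (mon \<one> (Suc 0)) = (\<lambda>j. \<one> \<otimes> (Z ^^ i) (Z (mon \<one> 0)) j)"
    by (simp add: diff_mult_mon up_seq Z_mon_one)
  also have "\<dots> = mon \<one> (Suc i)"
    using Zi_mon_one[of "Suc i"] by (simp add: funpow_swap1 up_seq Z_mon_one)
  finally show ?case using Suc by (simp add: diff_ring_def nat_pow_def)
qed (simp add: diff_ring_def nat_pow_def mon_def)

lemma finsum_diff_ring:
  assumes "finite S" "\<And>i. i \<in> S \<Longrightarrow> g i \<in> up A"
  shows "(\<Oplus>\<^bsub>diff_ring\<^esub>i\<in>S. g i) j = (\<Oplus>i\<in>S. g i j)"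
proof -
  interpret B: ring diff_ring by (rule ring_diff_ring)
  have [simp]: "carrier diff_ring = up A" by (simp add: diff_ring_def)
  show ?thesis using assms
  proof (induction S rule: finite_induct)
    case (insert x S)
    then have "(\<Oplus>\<^bsub>diff_ring\<^esub>i\<in>insert x S. g i) = g x \<oplus>\<^bsub>diff_ring\<^esub> (\<Oplus>\<^bsub>diff_ring\<^esub>i\<in>S. g i)"
      by (intro B.finsum_insert) auto
    then show ?case using insert by (simp add: diff_ring_def Pi_def)
  qed (simp only: B.finsum_empty finsum_empty, simp add: diff_ring_def)
qed

lemma diff_op_ring_model: "diff_op_ring A D diff_ring (\<lambda>a. mon a 0) (mon \<one> (Suc 0))"
  unfolding diff_op_ring_def
proof (intro conjI ballI)
  have mult: "mon a 0 \<otimes>\<^bsub>diff_ring\<^esub> q = (\<lambda>j. a \<otimes> q j)" if "a \<in> carrier A" "q \<in> up A" for a q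
    using that by (simp add: diff_ring_def diff_mult_mon up_seq)
  show "(\<lambda>a. mon a 0) \<in> ring_hom A diff_ring"
    by (rule ring_hom_memI)
       (auto simp: mult fun_eq_iff, auto simp: diff_ring_def mon_def up_iff seq_def)
  show "mon \<one> (Suc 0) \<otimes>\<^bsub>diff_ring\<^esub> mon a 0 =
      mon a 0 \<otimes>\<^bsub>diff_ring\<^esub> mon \<one> (Suc 0) \<oplus>\<^bsub>diff_ring\<^esub> mon (D a) 0"
    if "a \<in> carrier A" for a
  proof -
    have "mon \<one> (Suc 0) \<otimes>\<^bsub>diff_ring\<^esub> mon a 0 = Z (mon a 0)"
      using that by (simp add: diff_ring_def diff_mult_mon up_seq)
    then show ?thesis
      using that by (auto simp: mult) (auto simp: diff_ring_def Z_def mon_def)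
  qed
  have expand: "(\<Oplus>\<^bsub>diff_ring\<^esub>i\<in>{i. a i \<noteq> \<zero>}. mon (a i) 0 \<otimes>\<^bsub>diff_ring\<^esub> mon \<one> (Suc 0) [^]\<^bsub>diff_ring\<^esub> i) = a"
    if "a \<in> up A" for a
  proof
    fix j
    obtain n where "\<forall>k>n. a k = \<zero>" using \<open>a \<in> up A\<close> by (auto simp: up_iff)
    then have "{i. a i \<noteq> \<zero>} \<subseteq> {..n}" by (auto simp: not_less[symmetric])
    then have fin: "finite {i. a i \<noteq> \<zero>}" by (rule finite_subset) simp
    have term_eq: "mon (a i) 0 \<otimes>\<^bsub>diff_ring\<^esub> mon \<one> (Suc 0) [^]\<^bsub>diff_ring\<^esub> i = mon (a i) i" for i
      using that by (simp add: diff_ring_pow mult) (auto simp: mon_def)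
    have "(\<Oplus>\<^bsub>diff_ring\<^esub>i\<in>{i. a i \<noteq> \<zero>}. mon (a i) i) j = (\<Oplus>i\<in>{i. a i \<noteq> \<zero>}. mon (a i) i j)"
      by (rule finsum_diff_ring) (use fin that in auto)
    also have "\<dots> = (\<Oplus>i\<in>insert j {i. a i \<noteq> \<zero>}. mon (a i) i j)"
      by (rule add.finprod_mono_neutral_cong_left) (use fin that in \<open>auto simp: mon_def\<close>)
    also have "\<dots> = (\<Oplus>i\<in>insert j {i. a i \<noteq> \<zero>}. if j = i then a i else \<zero>)"
      by (rule finsum_cong') (use that in \<open>auto simp: mon_def\<close>)
    also have "\<dots> = a j"
      by (rule finsum_singleton) (use fin that in auto)
    finally show "(\<Oplus>\<^bsub>diff_ring\<^esub>i\<in>{i. a i \<noteq> \<zero>}.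
        mon (a i) 0 \<otimes>\<^bsub>diff_ring\<^esub> mon \<one> (Suc 0) [^]\<^bsub>diff_ring\<^esub> i) j = a j"
      by (simp only: term_eq)
  qed
  show "\<exists>!a. a \<in> up A \<and> b = (\<Oplus>\<^bsub>diff_ring\<^esub>i\<in>{i. a i \<noteq> \<zero>}.
      mon (a i) 0 \<otimes>\<^bsub>diff_ring\<^esub> mon \<one> (Suc 0) [^]\<^bsub>diff_ring\<^esub> i)" if "b \<in> carrier diff_ring" for b
    using that expand by (intro ex1I[of _ b]) (auto simp: diff_ring_def)
qed (auto simp: ring_diff_ring, simp add: diff_ring_def)

end

end

theory Submission
  imports Defs
begin

text \<open>
  The first equality rests on one observation about the evaluation homomorphism
  \<open>ev : R\<langle>t\<rangle> \<rightarrow> B\<close>.  Since \<open>z h\<^sup>[\<^sup>i\<^sup>] - h\<^sup>[\<^sup>i\<^sup>] z = h\<^sup>[\<^sup>i\<^sup>+\<^sup>1\<^sup>]\<close>, the maps \<open>x \<mapsto> z ev(x) - ev(x) z\<close> and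
  \<open>x \<mapsto> ev(\<Delta> x)\<close> are derivations along \<open>ev\<close> that agree on the generators \<open>t\<close> and \<open>y\<^sub>i\<close>, so they
  coincide.  Hence \<open>ev\<close> turns the operator \<open>\<Delta> + \<rho>\<^sub>t\<close> into left multiplication by \<open>z\<close>
  (\<open>ev_Delta_plus_tvar\<close>), and the recursion defining \<open>U\<close> becomes
  \<open>ev(U\<^sub>n\<^sub>+\<^sub>1) = h z\<^sup>d ev(U\<^sub>n)\<close>, which is the first equality (\<open>ev_U\<close>).  Centrality of \<open>h\<close> makes
  \<open>ev\<close> a homomorphism: all derivatives of a central element are central, so the \<open>h\<^sup>[\<^sup>i\<^sup>]\<close> commute.

  For the second equality one has to know which monomials occur in \<open>U\<^sub>n\<^sub>,\<^sub>d\<close>.  Giving \<open>y\<^sub>i\<close> weight \<open>i\<close>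
  and \<open>t\<close> weight \<open>1\<close>, both \<open>\<Delta>\<close> and \<open>\<rho>\<^sub>t\<close> raise the weight by one, keep the number of \<open>y\<close>'s, keep
  all \<open>t\<close>'s on the right and never lower their number.  The innermost factor \<open>(\<Delta> + \<rho>\<^sub>t)\<^sup>d\<close> acts on \<open>1\<close>
  and produces \<open>t\<^sup>d\<close>, and the leftmost factor \<open>y\<^sub>0\<close> is not differentiated; so the monomials of \<open>U\<^sub>n\<^sub>,\<^sub>d\<close>
  have the form \<open>y\<^sub>0 y\<^sub>q t\<^sup>k\<close> with \<open>n - 1\<close> further indices \<open>q\<close>, total weight \<open>nd\<close> and \<open>k \<ge> d\<close>
  (\<open>keys_U_weighted\<close>).  Sorting the positive indices into a partition gives the index set of the
  double sum (\<open>keys_U\<close>), and distinct indices give distinct monomials (\<open>monomial_inj\<close>).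
\<close>

section \<open>Evaluation intertwines \<open>\<Delta> + \<rho>\<^sub>t\<close> with left multiplication\<close>

context evaluation_data
begin

text \<open>The inner derivation \<open>[b, \<cdot>]\<close> and \<open>\<Delta>\<close> correspond under evaluation because they do so on
  the generators; the induction is the product rule for both.\<close>

lemma ev_Delta_plus_tvar:
  assumes rel: "\<And>i. b \<otimes> f i = f i \<otimes> b \<oplus> f (Suc i)"
  shows "ev (Delta x + x * tvar) = b \<otimes> ev x"
proof -
  have gen: "b \<otimes> ev (word [g]) = ev (Delta (word [g])) \<oplus> ev (word [g]) \<otimes> b" for g
  proof (cases g)
    case T
    then show ?thesis
      by (simp add: Delta_t ev_0 evaluation_tvar flip: tvar_def)
  next
    case (Y i)
    have "ev (Delta (yvar i)) = f (Suc i)" "ev (yvar i) = f i"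
      by (simp_all add: Delta_y evaluation_yvar)
    then show ?thesis
      using Y rel[of i] by (simp add: a_comm flip: yvar_def)
  qed
  have "b \<otimes> ev x = ev (Delta x) \<oplus> ev x \<otimes> b"
  proof (induction x rule: rt_induct)
    case (add x y)
    then show ?case by (simp add: Delta_add ev_add r_distr l_distr a_ac)
  next
    case (minus x)
    then show ?case by (simp add: Delta_minus ev_minus r_minus l_minus minus_add)
  next
    case zero
    show ?case by (simp add: Delta_0 ev_0)
  next
    case (word w)
    show ?case
    proof (induction w)
      case Nil
      show ?case by (simp add: Delta_word ev_word ev_0)
    next
      case (Cons g w)
      let ?g = "word [g]" and ?w = "word w"
      have "b \<otimes> (ev ?g \<otimes> ev ?w) = (b \<otimes> ev ?g) \<otimes> ev ?w"
        by (simp add: m_assoc)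
      also have "\<dots> = ev (Delta ?g) \<otimes> ev ?w \<oplus> ev ?g \<otimes> (b \<otimes> ev ?w)"
        unfolding gen by (simp add: l_distr m_assoc)
      also have "\<dots> = (ev (Delta ?g) \<otimes> ev ?w \<oplus> ev ?g \<otimes> ev (Delta ?w)) \<oplus> (ev ?g \<otimes> ev ?w) \<otimes> b"
        by (simp add: Cons r_distr m_assoc a_ac)
      finally show ?case
        by (simp only: word_Cons[of g w] Delta_mult ev_mult ev_add)
    qed
  qed
  then show ?thesis by (simp add: ev_add ev_mult evaluation_tvar)
qed

lemma ev_U:
  assumes "\<And>i. b \<otimes> f i = f i \<otimes> b \<oplus> f (Suc i)"
  shows "ev (U n d) = (f 0 \<otimes> b [^] d) [^] n"
proof (induction n)
  case 0
  show ?case using ev_word[of "[]"] by (simp add: word_Nil)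
next
  case (Suc n)
  have "ev (((\<lambda>x. Delta x + x * tvar) ^^ j) x) = b [^] j \<otimes> ev x" for j x
  proof (induction j)
    case (Suc j)
    have "b \<otimes> (b [^] j \<otimes> ev x) = b [^] Suc j \<otimes> ev x"
      by (simp only: nat_pow_Suc2 b_closed m_assoc nat_pow_closed ev_closed)
    then show ?case
      using Suc by (simp add: ev_Delta_plus_tvar[OF assms])
  qed simp
  then show ?case
    using Suc
    by (simp only: U.simps ev_mult evaluation_yvar nat_pow_Suc2 m_assoc nat_pow_closed m_closed
        f_closed b_closed)
qed

end


section \<open>The monomials of $U_{n,d}$\<close>

lemma abs_mono_append: "abs_mono (u @ v) = abs_mono u + abs_mono v"
  by (simp add: plus_mono.abs_eq)

lemma keys_word: "Poly_Mapping.keys (word w) = {abs_mono w}"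
  by (simp add: word_def)

lemma keys_mult_subset:
  fixes x z :: rt
  assumes "Poly_Mapping.keys x \<subseteq> M" "Poly_Mapping.keys z \<subseteq> N"
    and "\<And>a b. a \<in> M \<Longrightarrow> b \<in> N \<Longrightarrow> a + b \<in> L"
  shows "Poly_Mapping.keys (x * z) \<subseteq> L"
  using keys_mult[of x z] assms by blast

lemma keys_add_subset:
  assumes "Poly_Mapping.keys x \<subseteq> M" "Poly_Mapping.keys z \<subseteq> M"
  shows "Poly_Mapping.keys (x + z) \<subseteq> M"
  using keys_add[of x z] assms by blast

lemma Delta_word_T: "Delta_word (replicate k T) = 0"
  by (induction k) auto

lemma keys_Delta_word_Y:
  "Poly_Mapping.keys (Delta_word (map Y q))
     \<subseteq> {abs_mono (map Y r) | r. length r = length q \<and> sum_list r = Suc (sum_list q)}"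
proof (induction q)
  case (Cons i q)
  let ?L = "{abs_mono (map Y r) | r. length r = length (i # q) \<and> sum_list r = Suc (sum_list (i # q))}"
  have "Poly_Mapping.keys (word [Y (Suc i)] * word (map Y q)) \<subseteq> ?L"
  proof -
    have "abs_mono (map Y (Suc i # q)) \<in> ?L" by (intro CollectI exI[of _ "Suc i # q"]) simp
    then show ?thesis by (simp add: keys_word flip: word_append)
  qed
  moreover have "Poly_Mapping.keys (word [Y i] * Delta_word (map Y q)) \<subseteq> ?L"
  proof (rule keys_mult_subset[OF _ Cons])
    fix a c
    assume "a \<in> {abs_mono [Y i]}"
      and "c \<in> {abs_mono (map Y r) | r. length r = length q \<and> sum_list r = Suc (sum_list q)}"
    then obtain r where "a + c = abs_mono [Y i] + abs_mono (map Y r)"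
      and "length r = length q" "sum_list r = Suc (sum_list q)"
      by blast
    moreover have "abs_mono [Y i] + abs_mono (map Y r) = abs_mono (map Y (i # r))"
      by (simp flip: abs_mono_append)
    ultimately show "a + c \<in> ?L" by (intro CollectI exI[of _ "i # r"]) simp
  qed (simp add: keys_word)
  ultimately show ?case by (simp add: yvar_def keys_add_subset)
qed simp

text \<open>Words with the \<open>t\<close>'s on the right, of weight \<open>N\<close> when \<open>y\<^sub>i\<close> has weight \<open>i\<close> and \<open>t\<close> has
  weight \<open>1\<close>.  The number \<open>n\<close> of \<open>y\<close>'s and the lower bound \<open>c\<close> on the number of \<open>t\<close>'s are the
  quantities that \<open>\<Delta> + \<rho>\<^sub>t\<close> preserves.\<close>

definition weighted_monos :: "nat \<Rightarrow> nat \<Rightarrow> nat \<Rightarrow> mono set" where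
  "weighted_monos n N c = {abs_mono (map Y q @ replicate k T) | q k.
     length q = n \<and> sum_list q + k = N \<and> c \<le> k}"

lemma weighted_monos_step:
  assumes x: "Poly_Mapping.keys x \<subseteq> weighted_monos n N c"
  shows "Poly_Mapping.keys (Delta x + x * tvar) \<subseteq> weighted_monos n (Suc N) c"
proof (rule keys_add_subset)
  have "Poly_Mapping.keys (Delta_mono m) \<subseteq> weighted_monos n (Suc N) c"
    if m_in: "m \<in> weighted_monos n N c" for m
  proof -
    obtain q k where m: "m = abs_mono (map Y q @ replicate k T)"
      and q: "length q = n" "sum_list q + k = N" "c \<le> k"
      using m_in unfolding weighted_monos_def by blast
    have "Poly_Mapping.keys (Delta_word (map Y q) * word (replicate k T)) \<subseteq> weighted_monos n (Suc N) c"
      by (rule keys_mult_subset[OF keys_Delta_word_Y order_refl])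
         (use q in \<open>force simp: keys_word weighted_monos_def simp flip: abs_mono_append\<close>)
    then show ?thesis
      by (simp add: m Delta_mono.abs_eq Delta_word_append Delta_word_T)
  qed
  then have "Poly_Mapping.keys (of_int (Poly_Mapping.lookup x m) * Delta_mono m)
      \<subseteq> weighted_monos n (Suc N) c" if "m \<in> Poly_Mapping.keys x" for m
    using that x by (intro keys_mult_subset[of _ "{0}"]) (auto simp flip: single_of_int)
  then show "Poly_Mapping.keys (Delta x) \<subseteq> weighted_monos n (Suc N) c"
    unfolding Delta_def by (intro order_trans[OF keys_sum]) blast
  show "Poly_Mapping.keys (x * tvar) \<subseteq> weighted_monos n (Suc N) c"
  proof (rule keys_mult_subset[OF x, of _ "{abs_mono [T]}"])
    fix a e assume "a \<in> weighted_monos n N c" "e \<in> {abs_mono [T]}"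
    then obtain q k where "a + e = abs_mono (map Y q @ replicate (Suc k) T)"
      and "length q = n" "sum_list q + k = N" "c \<le> k"
      by (auto simp: weighted_monos_def replicate_append_same simp flip: abs_mono_append)
    then show "a + e \<in> weighted_monos n (Suc N) c"
      unfolding weighted_monos_def by force
  qed (simp add: tvar_def keys_word)
qed

lemma weighted_monos_iterate:
  assumes "Poly_Mapping.keys x \<subseteq> weighted_monos n N c"
  shows "Poly_Mapping.keys (((\<lambda>x. Delta x + x * tvar) ^^ j) x) \<subseteq> weighted_monos n (N + j) c"
  by (induction j) (use assms weighted_monos_step in auto)

lemma keys_yvar_mult_weighted:
  assumes "Poly_Mapping.keys x \<subseteq> weighted_monos n N c"
  shows "Poly_Mapping.keys (yvar 0 * x) \<subseteq> {abs_mono (map Y (0 # q) @ replicate k T) | q k.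
     length q = n \<and> sum_list q + k = N \<and> c \<le> k}"
proof (rule keys_mult_subset[OF _ assms, of _ "{abs_mono [Y 0]}"])
  fix a e assume "a \<in> {abs_mono [Y 0]}" "e \<in> weighted_monos n N c"
  then show "a + e \<in> {abs_mono (map Y (0 # q) @ replicate k T) | q k.
      length q = n \<and> sum_list q + k = N \<and> c \<le> k}"
    by (force simp: weighted_monos_def simp flip: abs_mono_append)
qed (simp add: yvar_def keys_word)

text \<open>The induction bounds the operand \<open>(\<Delta> + \<rho>\<^sub>t)\<^sup>d U\<^sub>n\<close> of the leftmost \<open>y\<^sub>0\<close>: the first \<open>d\<close>
  applications act on \<open>1\<close> and can only produce \<open>t\<^sup>d\<close>, which then stays on the right.\<close>

lemma keys_U_weighted:
  "Poly_Mapping.keys (U (Suc n) d) \<subseteq> {abs_mono (map Y (0 # q) @ replicate k T) | q k.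
     length q = n \<and> sum_list q + k = Suc n * d \<and> d \<le> k}"
proof -
  let ?E = "\<lambda>x. Delta x + x * tvar"
  have "Poly_Mapping.keys ((?E ^^ d) (U n d)) \<subseteq> weighted_monos n (Suc n * d) d"
  proof (induction n)
    case 0
    have "Poly_Mapping.keys (U 0 d) \<subseteq> weighted_monos 0 0 0"
      by (auto simp: weighted_monos_def zero_mono.abs_eq)
    from weighted_monos_iterate[OF this, of d]
    \<comment> \<open>without \<open>y\<close>'s, all the weight is carried by \<open>t\<close>\<close>
    show ?case by (auto simp: weighted_monos_def)
  next
    case (Suc n)
    have "Poly_Mapping.keys (U (Suc n) d) \<subseteq> weighted_monos (Suc n) (Suc n * d) d"
      using keys_yvar_mult_weighted[OF Suc]
      by (fastforce simp: weighted_monos_def simp del: list.map)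
    from weighted_monos_iterate[OF this, of d] show ?case by (simp add: add.commute add.left_commute)
  qed
  then show ?thesis using keys_yvar_mult_weighted by simp
qed

lemma abs_mono_Y_permute: "mset q = mset r \<Longrightarrow> abs_mono (map Y q) = abs_mono (map Y r)"
proof (induction q arbitrary: r)
  case (Cons i q)
  then have "i \<in> set r" by (metis list.set_intros(1) mset_eq_setD)
  then obtain u v where r: "r = u @ i # v" by (auto simp: in_set_conv_decomp)
  have move: "abs_mono (map Y u) + abs_mono [Y i] = abs_mono [Y i] + abs_mono (map Y u)"
  proof (induction u)
    case Nil
    show ?case by (simp flip: abs_mono_append)
  next
    case (Cons j u)
    have "abs_mono [Y i, Y j] = abs_mono [Y j, Y i]"
      using comm_eq.swap[of "[]" i j "[]"] by (simp add: mono.abs_eq_iff)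
    then have "abs_mono [Y i] + abs_mono [Y j] = abs_mono [Y j] + abs_mono [Y i]"
      by (simp flip: abs_mono_append)
    then show ?case
      using Cons abs_mono_append[of "[Y j]" "map Y u"] by (simp add: add.assoc) (metis add.assoc)
  qed
  have "abs_mono (map Y (i # q)) = abs_mono [Y i] + abs_mono (map Y (u @ v))"
    using Cons.IH[of "u @ v"] Cons.prems r abs_mono_append[of "[Y i]" "map Y q"] by simp
  also have "\<dots> = abs_mono (map Y u) + abs_mono [Y i] + abs_mono (map Y v)"
    by (simp add: abs_mono_append move add.assoc)
  also have "\<dots> = abs_mono (map Y r)"
    by (simp add: r flip: abs_mono_append)
  finally show ?case .
qed simp

definition partition_mono :: "nat \<Rightarrow> nat \<Rightarrow> nat list \<Rightarrow> mono" where
  "partition_mono n k p = abs_mono (replicate (n - length p) (Y 0) @ map Y p @ replicate k T)"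

definition U_partitions :: "nat \<Rightarrow> nat \<Rightarrow> nat \<Rightarrow> nat list set" where
  "U_partitions n d k = {p \<in> partitions (n * d - k). length p \<le> n - 1}"

text \<open>Sorting the positive indices of a monomial yields its partition; the leading \<open>y\<^sub>0\<close> is why at
  most \<open>n - 1\<close> parts remain.\<close>

lemma keys_U:
  assumes "n \<ge> 1"
  shows "Poly_Mapping.keys (U n d) \<subseteq> (\<Union>k\<in>{d..n * d}. partition_mono n k ` U_partitions n d k)"
proof
  obtain n' where n: "n = Suc n'" using assms by (cases n) auto
  fix m assume "m \<in> Poly_Mapping.keys (U n d)"
  then obtain q k where m: "m = abs_mono (map Y (0 # q) @ replicate k T)"
    and q: "length q = n'" "sum_list q + k = n * d" "d \<le> k"
    using keys_U_weighted[of n' d] unfolding n by blast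
  define p where "p = rev (sort (filter (\<lambda>i. 0 < i) q))"
  have p_len: "length p \<le> n'"
    using q(1) length_filter_le[of "\<lambda>i. 0 < i" q] by (simp add: p_def)
  have "sum_list (filter (\<lambda>i. 0 < i) q) = sum_list q"
    by (induction q) auto
  then have "sum_list p = sum_list q"
    by (metis p_def mset_rev mset_sort sum_mset_sum_list)
  then have p: "p \<in> U_partitions n d k"
    using q(2) p_len by (auto simp: p_def U_partitions_def partitions_def sorted_wrt_rev n)
  have "mset (replicate (length q - length (filter (\<lambda>i. 0 < i) q)) 0 @ filter (\<lambda>i. 0 < i) q) = mset q"
  proof (induction q)
    case (Cons i q)
    then show ?case
      using length_filter_le[of "\<lambda>i. 0 < i" q] by (cases i) (auto simp: Suc_diff_le)
  qed simp
  then have "mset (replicate (n - length p) 0 @ p) = mset (0 # q)"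
    using q(1) p_len by (simp add: n Suc_diff_le p_def)
  then have "abs_mono (map Y (0 # q)) = abs_mono (map Y (replicate (n - length p) 0 @ p))"
    by (intro abs_mono_Y_permute) simp
  then have "m = partition_mono n k p"
    unfolding m partition_mono_def
    by (simp add: abs_mono_append add.assoc del: list.map(2))
  then show "m \<in> (\<Union>k\<in>{d..n * d}. partition_mono n k ` U_partitions n d k)"
    using p q by auto
qed

text \<open>The monomial basis turns the sum over the support of $U_{n,d}$ into the double sum over
  degrees and partitions.\<close>

lemma (in evaluation_data) ev_U_partitions:
  assumes "n \<ge> 1"
  shows "ev (U n d) = (\<Oplus>k\<in>{d..n * d}. \<Oplus>p\<in>U_partitions n d k. [coeff_U n d p] \<cdot>
     (ew (replicate (n - length p) (Y 0)) \<otimes> ew (map Y p) \<otimes> b [^] k))"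
proof -
  let ?t = "\<lambda>m. [Poly_Mapping.lookup (U n d) m] \<cdot> ew (rep_mono m)"
  let ?K = "\<lambda>k. partition_mono n k ` U_partitions n d k"
  have fin: "finite (U_partitions n d k)" for k
    unfolding U_partitions_def using finite_partitions by simp
  have inj: "k = l \<and> p = r"
    if "partition_mono n k p = partition_mono n l r" "p \<in> U_partitions n d k" "r \<in> U_partitions n d l"
    for k l p r
    using that monomial_inj unfolding partition_mono_def U_partitions_def by blast
  have ewT: "ew (replicate k T) = b [^] k" for k
  proof (induction k)
    case (Suc k)
    then show ?case
      by (simp only: nat_pow_Suc2 b_closed replicate_Suc evaluation_word.simps gen.case)
  qed simp
  have "ev (U n d) = (\<Oplus>m\<in>(\<Union>k\<in>{d..n * d}. ?K k). ?t m)"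
    by (rule ev_superset) (use fin keys_U[OF assms] in auto)
  also have "\<dots> = (\<Oplus>k\<in>{d..n * d}. \<Oplus>m\<in>?K k. ?t m)"
    by (rule add.finprod_UN_disjoint) (use fin inj in \<open>auto simp: pairwise_def disjnt_def\<close>)
  also have "\<dots> = (\<Oplus>k\<in>{d..n * d}. \<Oplus>p\<in>U_partitions n d k. ?t (partition_mono n k p))"
    by (intro finsum_cong' refl finsum_reindex) (use inj in \<open>auto simp: inj_on_def intro!: finsum_closed\<close>)
  also have "\<dots> = (\<Oplus>k\<in>{d..n * d}. \<Oplus>p\<in>U_partitions n d k. [coeff_U n d p] \<cdot>
     (ew (replicate (n - length p) (Y 0)) \<otimes> ew (map Y p) \<otimes> b [^] k))"
  proof (intro finsum_cong' refl)
    fix k p assume "k \<in> {d..n * d}" "p \<in> U_partitions n d k"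
    then have "n * d - sum_list p = k" by (auto simp: U_partitions_def partitions_def)
    then have "Poly_Mapping.lookup (U n d) (partition_mono n k p) = coeff_U n d p"
      by (simp add: coeff_U_def partition_mono_def)
    moreover have "ew (rep_mono (partition_mono n k p))
        = ew (replicate (n - length p) (Y 0)) \<otimes> ew (map Y p) \<otimes> b [^] k"
      unfolding partition_mono_def ew_rep by (simp add: ew_append ewT m_assoc)
    ultimately show "?t (partition_mono n k p) = [coeff_U n d p] \<cdot>
        (ew (replicate (n - length p) (Y 0)) \<otimes> ew (map Y p) \<otimes> b [^] k)"
      by simp
  qed (auto intro!: finsum_closed)
  finally show ?thesis .
qed


section \<open>Derivatives of a central element\<close>

context derivation_ring
begin

lemma funpow_D_closed [simp, intro]: "h \<in> carrier A \<Longrightarrow> (D ^^ i) h \<in> carrier A"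
  by (induction i) auto

text \<open>Apply \<open>D\<close> to \<open>h a = a h\<close> and cancel \<open>h D(a) = D(a) h\<close>.\<close>

lemma D_central:
  assumes h: "h \<in> carrier A" "\<forall>a\<in>carrier A. h \<otimes> a = a \<otimes> h" and a: "a \<in> carrier A"
  shows "D h \<otimes> a = a \<otimes> D h"
proof -
  have "D h \<otimes> a \<oplus> h \<otimes> D a = D (a \<otimes> h)"
    using h a D_mult[of h a] by simp
  also have "\<dots> = a \<otimes> D h \<oplus> h \<otimes> D a"
    using h a D_mult[of a h] by (simp add: a_comm)
  finally show ?thesis
    using h a by (simp add: add.right_cancel)
qed

lemma funpow_D_central:
  assumes "h \<in> carrier A" "\<forall>a\<in>carrier A. h \<otimes> a = a \<otimes> h"
  shows "\<forall>a\<in>carrier A. (D ^^ i) h \<otimes> a = a \<otimes> (D ^^ i) h"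
  by (induction i) (use assms D_central in auto)

lemma deriv_prod_closed [simp, intro]: "h \<in> carrier A \<Longrightarrow> deriv_prod A D h p \<in> carrier A"
  by (induction p) (auto simp: deriv_prod_def)

end


section \<open>Powers in the formal differential operator ring\<close>

theorem theorem7p2:
  fixes A :: "('a, 'm) ring_scheme" and B :: "('b, 'k) ring_scheme"
    and D :: "'a \<Rightarrow> 'a" and \<iota> :: "'a \<Rightarrow> 'b" and z :: 'b and h :: 'a and n d :: nat
  assumes "ring A"
    and "derivation A D"
    and "h \<in> carrier A"
    and "\<forall>a\<in>carrier A. h \<otimes>\<^bsub>A\<^esub> a = a \<otimes>\<^bsub>A\<^esub> h"
    and "diff_op_ring A D B \<iota> z"
    and "n \<ge> 1"
    and "d \<ge> 1"
  shows "(\<iota> h \<otimes>\<^bsub>B\<^esub> z [^]\<^bsub>B\<^esub> d) [^]\<^bsub>B\<^esub> n = evaluation B (\<lambda>i. \<iota> ((D ^^ i) h)) z (U n d)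
    \<and> evaluation B (\<lambda>i. \<iota> ((D ^^ i) h)) z (U n d) =
      (\<Oplus>\<^bsub>B\<^esub>k\<in>{d..n * d}. \<Oplus>\<^bsub>B\<^esub>p\<in>{p \<in> partitions (n * d - k). length p \<le> n - 1}.
         [coeff_U n d p] \<cdot>\<^bsub>B\<^esub>
           (\<iota> (h [^]\<^bsub>A\<^esub> (n - length p) \<otimes>\<^bsub>A\<^esub> deriv_prod A D h p) \<otimes>\<^bsub>B\<^esub> z [^]\<^bsub>B\<^esub> k))"
proof -
  interpret A: derivation_ring A D
    using assms by (simp add: derivation_ring_def derivation_ring_axioms_def)
  have hom: "\<iota> \<in> ring_hom A B" and z: "z \<in> carrier B"
    and rel: "\<And>a. a \<in> carrier A \<Longrightarrow> z \<otimes>\<^bsub>B\<^esub> \<iota> a = \<iota> a \<otimes>\<^bsub>B\<^esub> z \<oplus>\<^bsub>B\<^esub> \<iota> (D a)"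
    and B: "ring B"
    using assms(5) by (auto simp: diff_op_ring_def)
  note h = assms(3)
  let ?f = "\<lambda>i. \<iota> ((D ^^ i) h)"
  have mult: "\<iota> (a \<otimes>\<^bsub>A\<^esub> c) = \<iota> a \<otimes>\<^bsub>B\<^esub> \<iota> c" if "a \<in> carrier A" "c \<in> carrier A" for a c
    using hom that by (rule ring_hom_mult)
  interpret evaluation_data B ?f z
  proof (intro evaluation_data.intro evaluation_data_axioms.intro B z)
    show "?f i \<in> carrier B" for i
      using h hom by (auto intro: ring_hom_closed)
    show "?f i \<otimes>\<^bsub>B\<^esub> ?f j = ?f j \<otimes>\<^bsub>B\<^esub> ?f i" for i j
      using A.funpow_D_central[OF h assms(4), of i] h by (simp flip: mult)
  qed
  have frel: "z \<otimes>\<^bsub>B\<^esub> ?f i = ?f i \<otimes>\<^bsub>B\<^esub> z \<oplus>\<^bsub>B\<^esub> ?f (Suc i)" for i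
    using rel[of "(D ^^ i) h"] h by simp
  have "ew (replicate j (Y 0)) = \<iota> (h [^]\<^bsub>A\<^esub> j)" for j
  proof (induction j)
    case (Suc j)
    then show ?case
      using h by (simp only: A.nat_pow_Suc2 replicate_Suc evaluation_word.simps gen.case mult
          A.nat_pow_closed funpow_0)
  qed (use hom in \<open>simp add: ring_hom_one\<close>)
  moreover have "ew (map Y p) = \<iota> (deriv_prod A D h p)" for p
  proof (induction p)
    case (Cons i p)
    have "deriv_prod A D h (i # p) = (D ^^ i) h \<otimes>\<^bsub>A\<^esub> deriv_prod A D h p"
      by (simp add: deriv_prod_def)
    then show ?case using Cons h by (simp add: mult)
  qed (use hom in \<open>simp add: deriv_prod_def ring_hom_one\<close>)
  ultimately show ?thesis
    using ev_U[OF frel, of n d] ev_U_partitions[OF assms(6), of d] h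
    by (simp add: mult U_partitions_def)
qed

end
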